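(* Let $\mathcal{S}$ be the set of all (non-degenerate) line segments in $\mathbb{R}^2$ whose slope belongs to the standard middle-thirds Cantor set in $[0,1]$, and for a function $f$ on $\mathbb{R}^2$ that is locally integrable on lines define $\mathcal{M} f(x) = \sup_{x \in s \in \mathcal{S}} \operatorname{av}_s |f|$. Then for every $1 \leq p < \infty$ the operator $\mathcal{M}$ is unbounded on $L^p(\mathbb{R}^2)$; that is, there is no finite constant $C$ such that $\|\mathcal{M} f\|_{L^p(\mathbb{R}^2)} \leq C \|f\|_{L^p(\mathbb{R}^2)}$ for all $f \in L^p(\mathbb{R}^2)$ that are locally integrable on lines.
   Context: For a line segment $s$ and a function $f$ locally integrable on lines (i.e. the restriction of $f$ to every line is locally integrable with respect to one-dimensional Lebesgue measure on that line), $\operatorname{av}_s(f)$ is the average of $f$ over $s$ with respect to one-dimensional Lebesgue (length) measure. The supremum in the definition of $\mathcal{M}f(x)$ runs over all segments $s \in \mathcal{S}$ containing the point $x$. *)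

theory Defs
  imports "HOL-Analysis.Analysis"
begin

type_synonym plane = "real \<times> real"

primrec cantor_stage :: "nat \<Rightarrow> real set" where
  "cantor_stage 0 = {0..1}"
| "cantor_stage (Suc n) =
     (\<lambda>x. x / 3) ` cantor_stage n \<union> (\<lambda>x. (x + 2) / 3) ` cantor_stage n"

definition cantor_set :: "real set" where
  "cantor_set = (\<Inter>n. cantor_stage n)"

definition slope :: "plane \<Rightarrow> plane \<Rightarrow> real" where
  "slope a b = (snd b - snd a) / (fst b - fst a)"

(* The segment closed_segment a b is encoded by its left endpoint a and its right endpoint b.
   The strict inequality makes the encoding unique and rules out both degenerate segments and
   vertical ones, to which division by zero would assign slope 0. *)
definition cantor_segments :: "(plane \<times> plane) set" where
  "cantor_segments = {(a, b). fst a < fst b \<and> slope a b \<in> cantor_set}"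

(* sgn (b - a) is the unit vector pointing from a to b, so the segment is parametrised by
   arc length. *)
definition segment_average :: "plane \<Rightarrow> plane \<Rightarrow> (plane \<Rightarrow> real) \<Rightarrow> real" where
  "segment_average a b f =
     (LINT t:{0..dist a b}|lebesgue. f (a + t *\<^sub>R sgn (b - a))) / dist a b"

definition locally_integrable_on_lines :: "(plane \<Rightarrow> real) \<Rightarrow> bool" where
  "locally_integrable_on_lines f \<longleftrightarrow>
     (\<forall>a u. norm u = 1 \<longrightarrow>
        (\<forall>r s. set_integrable lebesgue {r..s} (\<lambda>t. f (a + t *\<^sub>R u))))"

definition cantor_maximal :: "(plane \<Rightarrow> real) \<Rightarrow> plane \<Rightarrow> ennreal" where
  "cantor_maximal f x =
     (SUP (a, b)\<in>{(a, b) \<in> cantor_segments. x \<in> closed_segment a b}.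
        ennreal (segment_average a b (\<lambda>y. \<bar>f y\<bar>)))"

(* Meant for exponents p > 0, where the p-th power of infinity is infinity. *)
definition ennreal_powr :: "ennreal \<Rightarrow> real \<Rightarrow> ennreal" where
  "ennreal_powr x p = (if x = \<infinity> then \<infinity> else ennreal (enn2real x powr p))"

(* If F is not Lebesgue measurable, nn_integral is a lower integral; a lower bound on
   Lp_norm p F is then also a lower bound for the corresponding upper integral. *)
definition Lp_norm :: "real \<Rightarrow> (plane \<Rightarrow> ennreal) \<Rightarrow> ennreal" where
  "Lp_norm p F = ennreal_powr (\<integral>\<^sup>+ x. ennreal_powr (F x) p \<partial>lebesgue) (1 / p)"

definition in_Lp :: "real \<Rightarrow> (plane \<Rightarrow> real) \<Rightarrow> bool" where
  "in_Lp p f \<longleftrightarrow>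
     f \<in> borel_measurable lebesgue \<and> Lp_norm p (\<lambda>x. ennreal \<bar>f x\<bar>) < \<infinity>"

end

theory Submission
  imports Defs
begin

text \<open>The construction is the random sticky map of Bateman and Katz. A ternary tree of depth \<open>n\<close>
  whose edges carry random bits assigns to each intercept \<open>a \<in> 3\<^sup>-\<^sup>n \<int> \<inter> [0, 1)\<close> a slope \<open>\<sigma> a\<close> with
  \<open>n\<close> ternary digits in \<open>{0, 2}\<close>, and one considers the \<open>3\<^sup>n\<close> tubes
  \<open>a + \<sigma> a x \<le> y < a + \<sigma> a x + 3\<^sup>-\<^sup>n\<close>. Over \<open>1 \<le> x \<le> 2\<close>, covering \<open>(x, y)\<close> is survival of critical
  percolation on a tree with about \<open>2\<^sup>j\<close> vertices at level \<open>j\<close>, so Lyons' conductance bound gives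
  probability \<open>O(1 / n)\<close>. Over \<open>0 \<le> x \<le> 1\<close>, by stickiness two tubes through \<open>(x, y)\<close> can
  branch at level \<open>j\<close> only if their intercepts lie within \<open>3\<^sup>-\<^sup>j x\<close> of a triadic boundary of that level,
  so a second moment argument gives expected measure at least \<open>1 / (1 + 6 n x)\<close> in \<open>y\<close>, which integrates to order \<open>ln n / n\<close>. For the indicator
  of the tubes over \<open>[1, 2]\<close> the maximal function is at least \<open>1 / 2\<close> on the tubes over \<open>[0, 1]\<close>,
  whose measure is thus larger by a factor of order \<open>ln n\<close>.\<close>

subsection \<open>Sticky maps and their tubes\<close>

text \<open>The children are the intercept digits 0, 1, 2 in this order; the Boolean before each
  picks the slope digit 0 or 2 on the edge to it. Slope digits are read along the path of the
  intercept, so intercepts agreeing in their first digits have slopes agreeing in as many: this is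
  stickiness.\<close>

datatype sticky = Leaf | Node bool sticky bool sticky bool sticky

abbreviation digit :: "bool \<Rightarrow> real" where
  "digit b \<equiv> 2 * of_bool b"

text \<open>The number of tubes through \<open>(x, y)\<close>. The recursion splits off the first ternary digits \<open>i\<close>
  of the intercept and \<open>d\<close> of the slope: \<open>y = a + c x\<close> with \<open>a = (i + a') / 3\<close> and \<open>c = (d + c') / 3\<close>
  means \<open>3 y - i - d x = a' + c' x\<close>.\<close>

primrec overlap :: "sticky \<Rightarrow> real \<Rightarrow> real \<Rightarrow> real" where
  "overlap Leaf x y = indicator {0..<1} y"
| "overlap (Node a r b s c t) x y =
     overlap r x (3 * y - 0 - digit a * x) + overlap s x (3 * y - 1 - digit b * x)
     + overlap t x (3 * y - 2 - digit c * x)"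

definition hit :: "sticky \<Rightarrow> real \<Rightarrow> real \<Rightarrow> real" where
  "hit t x y = indicator {0<..} (overlap t x y)"

lemma overlap_nonneg: "0 \<le> overlap t x y"
  by (induction t arbitrary: y) auto

lemma overlap_support:
  assumes "0 \<le> x" "overlap t x y \<noteq> 0"
  shows "0 \<le> y \<and> y < 1 + x"
  using assms(2)
proof (induction t arbitrary: y)
  case Leaf
  then show ?case using assms(1) by (auto simp: indicator_def split: if_splits)
next
  case (Node a r b s c t)
  from Node.prems consider "overlap r x (3 * y - 0 - digit a * x) \<noteq> 0"
    | "overlap s x (3 * y - 1 - digit b * x) \<noteq> 0" | "overlap t x (3 * y - 2 - digit c * x) \<noteq> 0"
    by fastforce
  then show ?case
    using Node.IH[of "3 * y - 0 - digit a * x"] Node.IH[of "3 * y - 1 - digit b * x"]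
      Node.IH[of "3 * y - 2 - digit c * x"] assms(1)
    by cases (cases a; cases b; cases c; force)+
qed

lemma borel_measurable_overlap [measurable (raw)]:
  assumes [measurable]: "f \<in> borel_measurable M" "g \<in> borel_measurable M"
  shows "(\<lambda>z. overlap t (f z) (g z)) \<in> borel_measurable M"
  using assms(2)
proof (induction t arbitrary: g)
  case Leaf
  then show ?case by simp
next
  case (Node a r b s c t)
  have [measurable]: "g \<in> borel_measurable M" by fact
  note [measurable] = Node.IH
  show ?case unfolding overlap.simps by measurable
qed

lemma borel_measurable_hit [measurable (raw)]:
  assumes [measurable]: "f \<in> borel_measurable M" "g \<in> borel_measurable M"
  shows "(\<lambda>z. hit t (f z) (g z)) \<in> borel_measurable M"
  unfolding hit_def by measurable

section \<open>Cantor slopes of the tubes\<close>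

lemma cantor_set_0: "0 \<in> cantor_set"
proof -
  have "0 \<in> cantor_stage n" for n
    by (induction n) (auto simp: image_iff intro: bexI[of _ 0])
  then show ?thesis by (simp add: cantor_set_def)
qed

lemma cantor_set_child:
  assumes "c \<in> cantor_set"
  shows "(digit b + c) / 3 \<in> cantor_set"
  unfolding cantor_set_def
proof (intro INT_I)
  fix n
  have c: "c \<in> cantor_stage m" for m
    using assms by (simp add: cantor_set_def)
  show "(digit b + c) / 3 \<in> cantor_stage n"
  proof (cases n)
    case 0
    then show ?thesis using c[of 0] by (cases b) auto
  next
    case (Suc m)
    then show ?thesis using c[of m] by (cases b) (auto simp: add.commute)
  qed
qed

text \<open>A point of a tube lies on a line with the slope of that tube, which stays inside it over
  all abscissas. The digits of the slope are 0 or 2, and the leaf supplies the tail 0.\<close>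

lemma overlap_pos_line:
  assumes "0 < overlap t x y"
  shows "\<exists>c\<in>cantor_set. \<forall>x'. 0 < overlap t x' (y + c * (x' - x))"
  using assms
proof (induction t arbitrary: y)
  case Leaf
  then show ?case by (intro bexI[OF _ cantor_set_0]) simp
next
  case (Node a r b s c t)
  have line: "\<exists>e\<in>cantor_set. \<forall>x'. 0 < overlap u x' (3 * (y + e * (x' - x)) - i - digit d * x')"
    if IH: "\<And>z. 0 < overlap u x z \<Longrightarrow> \<exists>c\<in>cantor_set. \<forall>x'. 0 < overlap u x' (z + c * (x' - x))"
      and pos: "0 < overlap u x (3 * y - i - digit d * x)" for u d i
  proof -
    obtain e where e: "e \<in> cantor_set"
      and pos: "\<And>x'. 0 < overlap u x' (3 * y - i - digit d * x + e * (x' - x))"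
      using IH[OF pos] by blast
    \<comment> \<open>In the coordinates of the child, a line of slope
      \<open>(digit d + e) / 3\<close> becomes one of slope \<open>e\<close>.\<close>
    have eq: "3 * (y + (digit d + e) / 3 * (x' - x)) - i - digit d * x'
        = 3 * y - i - digit d * x + e * (x' - x)" for x'
      by (simp add: field_simps)
    show ?thesis
      by (intro bexI[OF _ cantor_set_child[OF e, of d]]) (simp only: eq pos, simp)
  qed
  have nn: "0 \<le> overlap u x' z" for u x' z by (rule overlap_nonneg)
  from Node.prems consider "0 < overlap r x (3 * y - 0 - digit a * x)"
    | "0 < overlap s x (3 * y - 1 - digit b * x)" | "0 < overlap t x (3 * y - 2 - digit c * x)"
    by (smt (verit) overlap.simps(2))
  then show ?case
  proof cases
    case 1
    from line[OF Node.IH(1) 1] show ?thesis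
      unfolding overlap.simps using nn by (meson add_pos_nonneg)
  next
    case 2
    from line[OF Node.IH(2) 2] show ?thesis
      unfolding overlap.simps using nn by (meson add_pos_nonneg add_nonneg_pos)
  next
    case 3
    from line[OF Node.IH(3) 3] show ?thesis
      unfolding overlap.simps using nn by (meson add_nonneg_nonneg add_nonneg_pos)
  qed
qed

subsection \<open>Averages over all sticky maps\<close>

definition mean :: "'a set \<Rightarrow> ('a \<Rightarrow> real) \<Rightarrow> real" where
  "mean A g = (\<Sum>a\<in>A. g a) / card A"

lemma mean_const: "finite A \<Longrightarrow> A \<noteq> {} \<Longrightarrow> mean A (\<lambda>_. k) = k"
  by (simp add: mean_def)

lemma mean_add: "mean A (\<lambda>a. f a + g a) = mean A f + mean A g"
  by (simp add: mean_def sum.distrib add_divide_distrib)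

lemma mean_diff: "mean A (\<lambda>a. f a - g a) = mean A f - mean A g"
  by (simp add: mean_def sum_subtractf diff_divide_distrib)

lemma mean_cmult: "mean A (\<lambda>a. k * f a) = k * mean A f"
  by (simp add: mean_def sum_distrib_left)

lemma mean_multc: "mean A (\<lambda>a. f a * k) = mean A f * k"
  by (simp add: mean_def sum_distrib_right)

lemma mean_mono: "(\<And>a. a \<in> A \<Longrightarrow> f a \<le> g a) \<Longrightarrow> mean A f \<le> mean A g"
  by (simp add: mean_def divide_right_mono sum_mono)

lemma mean_Times: "mean (A \<times> B) f = mean A (\<lambda>a. mean B (\<lambda>b. f (a, b)))"
  by (simp add: mean_def sum.cartesian_product' card_cartesian_product
      sum_divide_distrib[symmetric] mult.commute)

lemma mean_bool: "mean UNIV f = (f False + f True) / 2"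
  by (simp add: mean_def UNIV_bool)

lemma mean_image: "inj_on h A \<Longrightarrow> mean (h ` A) f = mean A (\<lambda>a. f (h a))"
  by (simp add: mean_def sum.reindex card_image)

text \<open>Under the uniform distribution on this set the edge bits are independent fair
  coins.\<close>

primrec trees :: "nat \<Rightarrow> sticky set" where
  "trees 0 = {Leaf}"
| "trees (Suc n) =
     (\<lambda>((a, r), (b, s), (c, t)). Node a r b s c t) `
       ((UNIV \<times> trees n) \<times> (UNIV \<times> trees n) \<times> (UNIV \<times> trees n))"

lemma finite_trees: "finite (trees n)"
  by (induction n) auto

lemma trees_nonempty: "trees n \<noteq> {}"
  by (induction n) auto

lemmas mean_trees_const = mean_const[OF finite_trees trees_nonempty]

lemma mean_trees_Suc:
  "mean (trees (Suc n)) f =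
     mean (UNIV \<times> trees n) (\<lambda>(a, r). mean (UNIV \<times> trees n) (\<lambda>(b, s).
       mean (UNIV \<times> trees n) (\<lambda>(c, t). f (Node a r b s c t))))"
proof -
  have "inj_on (\<lambda>((a, r), (b, s), (c, t)). Node a r b s c t) A" for A
    by (auto simp: inj_on_def)
  then show ?thesis
    by (simp add: mean_image mean_Times case_prod_unfold)
qed

lemma mean_UNIV_Times_const: "mean (UNIV \<times> trees n) (\<lambda>_::bool \<times> sticky. k) = k"
  by (rule mean_const) (auto simp: finite_trees trees_nonempty)

text \<open>The probability that a random sticky map covers the point; \<open>mean_overlap\<close>
  and \<open>mean_overlap_sq\<close> are the first two moments of the number of tubes through
  it.\<close>

definition coverage :: "nat \<Rightarrow> real \<Rightarrow> real \<Rightarrow> real" where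
  "coverage n x y = mean (trees n) (\<lambda>t. hit t x y)"

definition mean_overlap :: "nat \<Rightarrow> real \<Rightarrow> real \<Rightarrow> real" where
  "mean_overlap n x y = mean (trees n) (\<lambda>t. overlap t x y)"

definition mean_overlap_sq :: "nat \<Rightarrow> real \<Rightarrow> real \<Rightarrow> real" where
  "mean_overlap_sq n x y = mean (trees n) (\<lambda>t. (overlap t x y)\<^sup>2)"

text \<open>An expectation over the fair bit on the edge to child \<open>i\<close>, whose
  coordinates are used.\<close>

definition branch :: "(real \<Rightarrow> real) \<Rightarrow> real \<Rightarrow> real \<Rightarrow> real \<Rightarrow> real" where
  "branch g x i y = (g (3 * y - i) + g (3 * y - i - 2 * x)) / 2"

lemma mean_branch:
  "mean (UNIV \<times> trees n) (\<lambda>(b, t). g t (3 * y - i - digit b * x))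
     = branch (\<lambda>z. mean (trees n) (\<lambda>t. g t z)) x i y"
  by (simp add: mean_Times mean_bool branch_def)

text \<open>A sum of nonnegative counts vanishes only if every term does. Independence of the
  subtrees then gives the product in \<open>coverage_Suc\<close>.\<close>

lemma hit_Node:
  "1 - hit (Node a r b s c t) x y =
    (1 - hit r x (3 * y - 0 - digit a * x)) * (1 - hit s x (3 * y - 1 - digit b * x))
      * (1 - hit t x (3 * y - 2 - digit c * x))"
  using overlap_nonneg[of r x "3 * y - 0 - digit a * x"] overlap_nonneg[of s x "3 * y - 1 - digit b * x"]
    overlap_nonneg[of t x "3 * y - 2 - digit c * x"]
  unfolding hit_def indicator_def overlap.simps by auto

lemma coverage_Suc:
  "coverage (Suc n) x y = 1 - (1 - branch (coverage n x) x 0 y) * (1 - branch (coverage n x) x 1 y)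
      * (1 - branch (coverage n x) x 2 y)"
proof -
  let ?X = "UNIV \<times> trees n"
  let ?h = "\<lambda>i z::bool \<times> sticky. 1 - hit (snd z) x (3 * y - i - digit (fst z) * x)"
  have h: "mean ?X (?h i) = 1 - branch (coverage n x) x i y" for i
    using mean_branch[of n "\<lambda>t. hit t x" y i x]
    by (simp add: mean_diff mean_UNIV_Times_const coverage_def[abs_def] case_prod_unfold)
  have "1 - coverage (Suc n) x y = mean (trees (Suc n)) (\<lambda>t. 1 - hit t x y)"
    by (simp only: coverage_def mean_diff mean_trees_const)
  also have "\<dots> = mean ?X (\<lambda>p. mean ?X (\<lambda>q. mean ?X (\<lambda>w. ?h 0 p * ?h 1 q * ?h 2 w)))"
    by (simp only: mean_trees_Suc hit_Node case_prod_unfold)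
  also have "\<dots> = mean ?X (?h 0) * mean ?X (?h 1) * mean ?X (?h 2)"
    by (simp only: mean_cmult mean_multc)
  finally show ?thesis by (simp only: h)
qed

lemma mean_overlap_Suc:
  "mean_overlap (Suc n) x y = branch (mean_overlap n x) x 0 y
    + branch (mean_overlap n x) x 1 y + branch (mean_overlap n x) x 2 y"
proof -
  let ?X = "UNIV \<times> trees n"
  let ?h = "\<lambda>i z::bool \<times> sticky. overlap (snd z) x (3 * y - i - digit (fst z) * x)"
  have h: "mean ?X (?h i) = branch (mean_overlap n x) x i y" for i
    using mean_branch[of n "\<lambda>t. overlap t x" y i x]
    by (simp add: mean_overlap_def[abs_def] case_prod_unfold)
  have "mean_overlap (Suc n) x y = mean ?X (\<lambda>p. mean ?X (\<lambda>q. mean ?X (\<lambda>w. ?h 0 p + ?h 1 q + ?h 2 w)))"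
    by (simp only: mean_overlap_def mean_trees_Suc overlap.simps case_prod_unfold)
  also have "\<dots> = mean ?X (?h 0) + mean ?X (?h 1) + mean ?X (?h 2)"
    by (simp only: mean_add mean_UNIV_Times_const)
  finally show ?thesis by (simp only: h)
qed

text \<open>Different children are independent, so the cross terms are products of first
  moments.\<close>

lemma mean_overlap_sq_Suc:
  "mean_overlap_sq (Suc n) x y = branch (mean_overlap_sq n x) x 0 y
    + branch (mean_overlap_sq n x) x 1 y + branch (mean_overlap_sq n x) x 2 y
    + 2 * (branch (mean_overlap n x) x 0 y * branch (mean_overlap n x) x 1 y
      + branch (mean_overlap n x) x 0 y * branch (mean_overlap n x) x 2 y
      + branch (mean_overlap n x) x 1 y * branch (mean_overlap n x) x 2 y)"
proof -
  let ?X = "UNIV \<times> trees n"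
  let ?h = "\<lambda>i z::bool \<times> sticky. overlap (snd z) x (3 * y - i - digit (fst z) * x)"
  have h: "mean ?X (?h i) = branch (mean_overlap n x) x i y" for i
    using mean_branch[of n "\<lambda>t. overlap t x" y i x]
    by (simp add: mean_overlap_def[abs_def] case_prod_unfold)
  have h2: "mean ?X (\<lambda>z. (?h i z)\<^sup>2) = branch (mean_overlap_sq n x) x i y" for i
    using mean_branch[of n "\<lambda>t z. (overlap t x z)\<^sup>2" y i x]
    by (simp add: mean_overlap_sq_def[abs_def] case_prod_unfold)
  have sq: "(a + b + c)\<^sup>2 = a\<^sup>2 + b\<^sup>2 + c\<^sup>2 + 2 * (a * b + a * c + b * c)" for a b c :: real
    by (simp add: power2_eq_square algebra_simps)
  have "mean_overlap_sq (Suc n) x y = mean ?X (\<lambda>p. mean ?X (\<lambda>q. mean ?X (\<lambda>w. (?h 0 p + ?h 1 q + ?h 2 w)\<^sup>2)))"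
    by (simp only: mean_overlap_sq_def mean_trees_Suc overlap.simps case_prod_unfold)
  also have "\<dots> = mean ?X (\<lambda>z. (?h 0 z)\<^sup>2) + mean ?X (\<lambda>z. (?h 1 z)\<^sup>2) + mean ?X (\<lambda>z. (?h 2 z)\<^sup>2)
    + 2 * (mean ?X (?h 0) * mean ?X (?h 1) + mean ?X (?h 0) * mean ?X (?h 2)
      + mean ?X (?h 1) * mean ?X (?h 2))"
    by (simp only: sq mean_add mean_cmult mean_multc mean_UNIV_Times_const)
  finally show ?thesis by (simp only: h h2)
qed

section \<open>Integrals, bounds and supports of the averages\<close>

lemma integral_affine3:
  fixes g :: "real \<Rightarrow> real"
  assumes "integrable lborel g"
  shows "integrable lborel (\<lambda>y. g (3 * y - e))"
    and "(\<integral>y. g (3 * y - e) \<partial>lborel) = (\<integral>y. g y \<partial>lborel) / 3"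
  using lborel_integrable_real_affine[OF assms, of 3 "-e"] lborel_integral_real_affine[of 3 g "-e"]
  by (simp_all add: algebra_simps)

lemma branch_integral:
  assumes "integrable lborel g"
  shows "integrable lborel (branch g x i)"
    and "(\<integral>y. branch g x i y \<partial>lborel) = (\<integral>y. g y \<partial>lborel) / 3"
  using integral_affine3[OF assms, of i] integral_affine3[OF assms, of "i + 2 * x"]
  by (simp_all add: branch_def[abs_def] diff_diff_eq)

lemma borel_measurable_mean [measurable]:
  assumes "\<And>a. a \<in> A \<Longrightarrow> f a \<in> borel_measurable M"
  shows "(\<lambda>z. mean A (\<lambda>a. f a z)) \<in> borel_measurable M"
  using assms unfolding mean_def by measurable

lemma borel_measurable_coverage [measurable]: "coverage n x \<in> borel_measurable borel"
  unfolding coverage_def[abs_def] by measurable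

lemma hit_bounds: "0 \<le> hit t x y" "hit t x y \<le> 1"
  by (auto simp: hit_def indicator_def)

lemma coverage_bounds: "0 \<le> coverage n x y" "coverage n x y \<le> 1"
proof -
  show "0 \<le> coverage n x y"
    using mean_mono[of "trees n" "\<lambda>_. 0" "\<lambda>t. hit t x y"]
    by (simp add: mean_trees_const coverage_def hit_bounds)
  show "coverage n x y \<le> 1"
    using mean_mono[of "trees n" "\<lambda>t. hit t x y" "\<lambda>_. 1"]
    by (simp add: mean_trees_const coverage_def hit_bounds)
qed

lemma mean_overlap_nonneg: "0 \<le> mean_overlap n x y"
  using mean_mono[of "trees n" "\<lambda>_. 0" "\<lambda>t. overlap t x y"]
  by (simp add: mean_trees_const mean_overlap_def overlap_nonneg)

lemma overlap_outside: "0 \<le> x \<Longrightarrow> \<not> (0 \<le> y \<and> y < 1 + x) \<Longrightarrow> overlap t x y = 0"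
  using overlap_support by blast

lemma mean_overlap_outside: "0 \<le> x \<Longrightarrow> \<not> (0 \<le> y \<and> y < 1 + x) \<Longrightarrow> mean_overlap n x y = 0"
  by (simp add: mean_overlap_def overlap_outside mean_trees_const)

lemma coverage_outside: "0 \<le> x \<Longrightarrow> \<not> (0 \<le> y \<and> y < 1 + x) \<Longrightarrow> coverage n x y = 0"
  by (simp add: coverage_def hit_def overlap_outside mean_trees_const)

lemma coverage_integrable:
  assumes "0 \<le> x"
  shows "integrable lborel (coverage n x)"
proof (rule integrableI_bounded_set[where A = "{0..<1 + x}" and B = 1])
  show "AE y in lborel. y \<notin> {0..<1 + x} \<longrightarrow> coverage n x y = 0"
    using coverage_outside[OF assms] by (intro AE_I2) auto
qed (use assms coverage_bounds in \<open>auto simp: abs_le_iff intro: order_trans[of _ 0] AE_I2\<close>)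

lemma mean_overlap_0: "mean_overlap 0 x y = indicator {0..<1} y"
  by (simp add: mean_overlap_def mean_def)

lemma mean_overlap_sq_0: "mean_overlap_sq 0 x y = indicator {0..<1} y"
  by (simp add: mean_overlap_sq_def mean_def indicator_def)

lemma coverage_0: "coverage 0 x y = indicator {0..<1} y"
  by (simp add: coverage_def hit_def mean_def indicator_def)

subsection \<open>Second moment bound\<close>

text \<open>Splitting off the last instead of the first digit of the slope exhibits \<open>mean_overlap\<close> as an
  average of indicators, which the recursion \<open>mean_overlap_Suc\<close> hides.\<close>

lemma mean_overlap_Suc_last:
  "mean_overlap (Suc n) x y = (mean_overlap n x y + mean_overlap n x (y - 2 * x / 3 ^ Suc n)) / 2"
proof (induction n arbitrary: y)
  case 0
  have "indicator {0..<1} (3 * z - 0) + indicator {0..<1} (3 * z - 1) + indicator {0..<1} (3 * z - 2)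
      = (indicator {0..<1} z :: real)" for z :: real
    by (auto simp: indicator_def)
  from this[of y] this[of "y - 2 * x / 3"] show ?case
    by (simp add: mean_overlap_Suc mean_overlap_0 branch_def algebra_simps add_divide_distrib)
next
  case (Suc n)
  define u where "u = 2 * x / 3 ^ Suc n"
  have u: "2 * x / 3 ^ Suc (Suc n) = u / 3" by (simp add: u_def)
  \<comment> \<open>The factor 3 inside \<open>branch\<close> turns the last shift
    \<open>u / 3\<close> of the deeper level into the shift \<open>u\<close> of the induction
    hypothesis.\<close>
  have e: "3 * (y - u / 3) - i = 3 * y - i - u" "3 * y - i - u - 2 * x = 3 * y - i - 2 * x - u" for i
    by simp_all
  have b: "branch (mean_overlap (Suc n) x) x i y
      = (branch (mean_overlap n x) x i y + branch (mean_overlap n x) x i (y - 2 * x / 3 ^ Suc (Suc n))) / 2" for i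
    unfolding branch_def Suc.IH u unfolding u_def[symmetric] e
    by (simp add: field_simps)
  show ?case
    unfolding mean_overlap_Suc[of "Suc n"] b mean_overlap_Suc[of n] by (simp add: field_simps)
qed

text \<open>The first-digit recursion adds three branches and would lose the bound 1; the last-digit
  recursion averages two values.\<close>

lemma mean_overlap_le_1: "mean_overlap n x y \<le> 1"
proof (induction n arbitrary: y)
  case 0
  show ?case by (simp add: mean_overlap_0)
next
  case (Suc n)
  show ?case using Suc[of y] Suc[of "y - 2 * x / 3 ^ Suc n"] unfolding mean_overlap_Suc_last by simp
qed

lemma mean_overlap_integral: "integrable lborel (mean_overlap n x) \<and> (\<integral>y. mean_overlap n x y \<partial>lborel) = 1"
proof (induction n)
  case 0
  show ?case by (simp add: mean_overlap_0[abs_def])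
next
  case (Suc n)
  then show ?case by (simp add: mean_overlap_Suc[abs_def] branch_integral)
qed

lemma branch_bounds: "0 \<le> branch (mean_overlap n x) x i y" "branch (mean_overlap n x) x i y \<le> 1"
  using mean_overlap_nonneg mean_overlap_le_1[of n x "3 * y - i"] mean_overlap_le_1[of n x "3 * y - i - 2 * x"]
  by (auto simp: branch_def)

lemma branch_outside:
  assumes "0 \<le> x" "\<not> (i \<le> 3 * y \<and> 3 * y < i + 1 + 3 * x)"
  shows "branch (mean_overlap n x) x i y = 0"
proof -
  have "mean_overlap n x (3 * y - i) = 0" "mean_overlap n x (3 * y - i - 2 * x) = 0"
    using assms by (intro mean_overlap_outside; linarith)+
  then show ?thesis by (simp add: branch_def)
qed

text \<open>Both factors are nonzero only within distance \<open>x\<close> of a triadic boundary; this is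
  why the tubes overlap less and less as \<open>x\<close> decreases to 0.\<close>

lemma branch_product:
  assumes x: "0 \<le> x" and "i + 1 \<le> k"
  shows "integrable lborel (\<lambda>y. branch (mean_overlap n x) x i y * branch (mean_overlap n x) x k y)"
    and "(\<integral>y. branch (mean_overlap n x) x i y * branch (mean_overlap n x) x k y \<partial>lborel) \<le> x"
proof -
  have int: "integrable lborel (branch (mean_overlap n x) x i)" for i
    using mean_overlap_integral branch_integral by blast
  then have [measurable]: "branch (mean_overlap n x) x i \<in> borel_measurable borel" for i
    by (auto dest: borel_measurable_integrable)
  show *: "integrable lborel (\<lambda>y. branch (mean_overlap n x) x i y * branch (mean_overlap n x) x k y)"
    by (rule Bochner_Integration.integrable_bound[OF int[of i]])
      (auto simp: branch_bounds abs_mult intro!: AE_I2 mult_left_le)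
  have "(\<integral>y. branch (mean_overlap n x) x i y * branch (mean_overlap n x) x k y \<partial>lborel)
      \<le> (\<integral>y. indicator {k / 3..k / 3 + x} y \<partial>lborel)"
  proof (rule integral_mono[OF *])
    fix y
    show "branch (mean_overlap n x) x i y * branch (mean_overlap n x) x k y \<le> indicator {k / 3..k / 3 + x} y"
    proof (cases "y \<in> {k / 3..k / 3 + x}")
      case True
      then show ?thesis by (simp add: branch_bounds mult_le_one)
    next
      case False
      \<comment> \<open>Two nonzero factors would force
        \<open>k \<le> 3 * y < i + 1 + 3 * x \<le> k + 3 * x\<close>.\<close>
      then have "branch (mean_overlap n x) x i y = 0 \<or> branch (mean_overlap n x) x k y = 0"
        using assms branch_outside[OF x, of i y n] branch_outside[OF x, of k y n] by force
      then show ?thesis by auto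
    qed
  qed (auto intro!: integrable_real_indicator simp: emeasure_lborel_Icc_eq)
  then show "(\<integral>y. branch (mean_overlap n x) x i y * branch (mean_overlap n x) x k y \<partial>lborel) \<le> x"
    using x by simp
qed

text \<open>The diagonal terms preserve the integral, three branches at one third each; every level
  adds twice three cross terms of integral at most \<open>x\<close>.\<close>

lemma mean_overlap_sq_integral:
  assumes "0 \<le> x"
  shows "integrable lborel (mean_overlap_sq n x) \<and> (\<integral>y. mean_overlap_sq n x y \<partial>lborel) \<le> 1 + 6 * n * x"
proof (induction n)
  case 0
  show ?case by (simp add: mean_overlap_sq_0[abs_def])
next
  case (Suc n)
  note p = branch_product[OF assms, of 0 1 n] branch_product[OF assms, of 0 2 n]
    branch_product[OF assms, of 1 2 n]
  show ?case
    using Suc p by (simp add: mean_overlap_sq_Suc[abs_def] branch_integral algebra_simps)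
qed

text \<open>The second moment method in linearised form: \<open>hit\<close> dominates a quadratic in
  the number of tubes, and the chosen \<open>l\<close> maximises
  \<open>2 * l - l^2 * (1 + 6 * n * x)\<close>.\<close>

lemma coverage_lower:
  assumes x: "0 \<le> x"
  shows "1 / (1 + 6 * n * x) \<le> (\<integral>y. coverage n x y \<partial>lborel)"
proof -
  define l where "l = 1 / (1 + 6 * n * x)"
  have l: "0 < l" "l * (1 + 6 * n * x) = 1"
    using x by (auto simp: l_def add_pos_nonneg add_nonneg_eq_0_iff)
  have "2 * l * mean_overlap n x y - l\<^sup>2 * mean_overlap_sq n x y \<le> coverage n x y" for y
  proof -
    have "2 * l * overlap t x y - l\<^sup>2 * (overlap t x y)\<^sup>2 \<le> hit t x y" for t
    proof (cases "0 < overlap t x y")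
      case True
      have "0 \<le> (1 - l * overlap t x y)\<^sup>2" by simp
      then show ?thesis using True
        by (simp add: hit_def power2_eq_square algebra_simps)
    next
      case False
      then have "overlap t x y = 0" using overlap_nonneg[of t x y] by simp
      then show ?thesis by (simp add: hit_def)
    qed
    then have "mean (trees n) (\<lambda>t. 2 * l * overlap t x y - l\<^sup>2 * (overlap t x y)\<^sup>2) \<le> coverage n x y"
      unfolding coverage_def by (intro mean_mono)
    then show ?thesis by (simp add: mean_diff mean_cmult mean_overlap_def mean_overlap_sq_def)
  qed
  then have "(\<integral>y. 2 * l * mean_overlap n x y - l\<^sup>2 * mean_overlap_sq n x y \<partial>lborel)
      \<le> (\<integral>y. coverage n x y \<partial>lborel)"
    using mean_overlap_integral[of n x] mean_overlap_sq_integral[OF x, of n] coverage_integrable[OF x]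
    by (intro integral_mono) auto
  then have "2 * l - l\<^sup>2 * (\<integral>y. mean_overlap_sq n x y \<partial>lborel) \<le> (\<integral>y. coverage n x y \<partial>lborel)"
    using mean_overlap_integral[of n x] mean_overlap_sq_integral[OF x, of n] by simp
  moreover have "l\<^sup>2 * (\<integral>y. mean_overlap_sq n x y \<partial>lborel) \<le> l\<^sup>2 * (1 + 6 * n * x)"
    using mean_overlap_sq_integral[OF x, of n] by (intro mult_left_mono) auto
  moreover have "l\<^sup>2 * (1 + 6 * n * x) = l"
    using l by (simp add: power2_eq_square mult.assoc)
  ultimately show ?thesis by (simp add: l_def)
qed

subsection \<open>Conductance bound\<close>

text \<open>Electrical network bound: a vertex of conductance \<open>C\<close> to the leaves is connected to them with
  probability at most \<open>2 C / (2 + C)\<close>. Passing to the parent doubles the resistance and adds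
  \<open>1 / 2\<close>, that is \<open>1 / attenuate C = 2 / C + 1 / 2\<close>, and siblings are in parallel. Equality holds at the
  leaves, where \<open>C = 2\<close>, and for only children.\<close>

definition attenuate :: "real \<Rightarrow> real" where
  "attenuate d = 2 * d / (4 + d)"

text \<open>The factor 2 undoes the averaging in \<open>branch\<close>: parallel conductances add
  over all six choices of an intercept and a slope digit.\<close>

primrec conductance :: "nat \<Rightarrow> real \<Rightarrow> real \<Rightarrow> real" where
  "conductance 0 x y = 2 * indicator {0..<1} y"
| "conductance (Suc n) x y =
     2 * (branch (\<lambda>z. attenuate (conductance n x z)) x 0 y
       + branch (\<lambda>z. attenuate (conductance n x z)) x 1 y
       + branch (\<lambda>z. attenuate (conductance n x z)) x 2 y)"

lemma attenuate_nonneg: "0 \<le> d \<Longrightarrow> 0 \<le> attenuate d"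
  by (simp add: attenuate_def)

lemma attenuate_le: "0 \<le> d \<Longrightarrow> attenuate d \<le> d"
  by (simp add: attenuate_def field_simps)

lemma conductance_nonneg: "0 \<le> conductance n x y"
  by (induction n arbitrary: y) (auto simp: branch_def attenuate_nonneg)

lemma conductance_outside: "0 \<le> x \<Longrightarrow> \<not> (0 \<le> y \<and> y < 1 + x) \<Longrightarrow> conductance n x y = 0"
proof (induction n arbitrary: y)
  case 0
  then show ?case by auto
next
  case (Suc n)
  have "conductance n x (3 * y - i) = 0 \<and> conductance n x (3 * y - i - 2 * x) = 0" if "i \<in> {0, 1, 2}" for i
    using that Suc.prems by (intro conjI Suc.IH) auto
  from this[of 0] this[of 1] this[of 2] show ?case by (simp add: branch_def attenuate_def)
qed

text \<open>Parallel connection of two independent siblings. The bound on missing is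
  \<open>(2 - C) / (2 + C)\<close>, which is at most the product of these quantities for the two
  summands of \<open>C\<close> while these sum to less than 2; beyond that the claimed bound is at
  least 1.\<close>

lemma union_bound:
  fixes a b \<alpha> \<beta> :: real
  assumes "0 \<le> \<alpha>" "\<alpha> \<le> 1" "0 \<le> \<beta>" "\<beta> \<le> 1" "0 \<le> a" "0 \<le> b"
    and "\<alpha> \<le> 2 * a / (2 + a)" "\<beta> \<le> 2 * b / (2 + b)"
  shows "1 - (1 - \<alpha>) * (1 - \<beta>) \<le> 2 * (a + b) / (2 + (a + b))"
proof (cases "a + b \<ge> 2")
  case True
  have "1 \<le> 2 * (a + b) / (2 + (a + b))" using True by (simp add: field_simps)
  moreover have "0 \<le> (1 - \<alpha>) * (1 - \<beta>)" using assms by simp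
  ultimately show ?thesis by linarith
next
  case False
  have a: "(2 - a) / (2 + a) \<le> 1 - \<alpha>" using assms by (simp add: field_simps)
  have b: "(2 - b) / (2 + b) \<le> 1 - \<beta>" using assms by (simp add: field_simps)
  \<comment> \<open>With denominators cleared, the sides below differ by a multiple of
    \<open>a * b * (a + b)\<close>.\<close>
  have "0 \<le> 4 * a * b * (a + b)" using assms by simp
  then have "(2 - (a + b)) / (2 + (a + b)) \<le> (2 - a) / (2 + a) * ((2 - b) / (2 + b))"
    using assms by (simp add: divide_simps) (simp add: algebra_simps)
  also have "\<dots> \<le> (1 - \<alpha>) * (1 - \<beta>)"
    using a b assms False by (intro mult_mono) auto
  finally show ?thesis using assms by (simp add: field_simps)
qed

text \<open>For \<open>1 \<le> x\<close> the two slope digits never both lead to coverage, so their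
  sharing of one bit is harmless and each acts as an edge open with probability 1/2.\<close>

lemma branch_coverage_le:
  fixes x y i :: real
  assumes x: "1 \<le> x" and IH: "\<And>z. coverage n x z \<le> 2 * conductance n x z / (2 + conductance n x z)"
  defines "b \<equiv> 2 * branch (\<lambda>z. attenuate (conductance n x z)) x i y"
  shows "branch (coverage n x) x i y \<le> 2 * b / (2 + b)"
proof -
  have half: "coverage n x z / 2
      \<le> 2 * attenuate (conductance n x z) / (2 + attenuate (conductance n x z))" for z
  proof -
    \<comment> \<open>Adding the edge resistance exactly halves the bound, matching the probability
      1/2 of the edge.\<close>
    have "2 * attenuate (conductance n x z) / (2 + attenuate (conductance n x z))
        = conductance n x z / (2 + conductance n x z)"
      using conductance_nonneg[of n x z] by (simp add: attenuate_def divide_simps)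
    then show ?thesis using IH[of z] by (simp add: mult.commute)
  qed
  have mono: "2 * d / (2 + d) \<le> 2 * e / (2 + e)" if "0 \<le> d" "d \<le> e" for d e :: real
    using that by (simp add: field_simps)
  have b: "b = attenuate (conductance n x (3 * y - i)) + attenuate (conductance n x (3 * y - i - 2 * x))"
    by (simp add: b_def branch_def)
  \<comment> \<open>The arguments differ by \<open>2 x\<close>, at least the length \<open>1 + x\<close> of the support.\<close>
  have "coverage n x (3 * y - i) = 0 \<or> coverage n x (3 * y - i - 2 * x) = 0"
    using x coverage_outside[of x "3 * y - i" n] coverage_outside[of x "3 * y - i - 2 * x" n] by linarith
  then show ?thesis
  proof
    assume "coverage n x (3 * y - i) = 0"
    then have "branch (coverage n x) x i y = coverage n x (3 * y - i - 2 * x) / 2" by (simp add: branch_def)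
    also note half
    also have "2 * attenuate (conductance n x (3 * y - i - 2 * x))
        / (2 + attenuate (conductance n x (3 * y - i - 2 * x)))
        \<le> 2 * b / (2 + b)"
      by (rule mono) (auto simp: b attenuate_nonneg conductance_nonneg)
    finally show ?thesis .
  next
    assume "coverage n x (3 * y - i - 2 * x) = 0"
    then have "branch (coverage n x) x i y = coverage n x (3 * y - i) / 2" by (simp add: branch_def)
    also note half
    also have "2 * attenuate (conductance n x (3 * y - i)) / (2 + attenuate (conductance n x (3 * y - i)))
        \<le> 2 * b / (2 + b)"
      by (rule mono) (auto simp: b attenuate_nonneg conductance_nonneg)
    finally show ?thesis .
  qed
qed

lemma coverage_le_conductance:
  assumes x: "1 \<le> x"
  shows "coverage n x y \<le> 2 * conductance n x y / (2 + conductance n x y)"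
proof (induction n arbitrary: y)
  case 0
  show ?case by (simp add: coverage_0 indicator_def)
next
  case (Suc n)
  let ?\<alpha> = "\<lambda>i. branch (coverage n x) x i y"
    and ?b = "\<lambda>i. 2 * branch (\<lambda>z. attenuate (conductance n x z)) x i y"
  have \<alpha>: "0 \<le> ?\<alpha> i" "?\<alpha> i \<le> 1" for i
    using coverage_bounds(1)[of n x] coverage_bounds(2)[of n x "3 * y - i"]
      coverage_bounds(2)[of n x "3 * y - i - 2 * x"]
    by (auto simp: branch_def)
  have b: "0 \<le> ?b i" for i
    by (simp add: branch_def attenuate_nonneg conductance_nonneg)
  have le: "?\<alpha> i \<le> 2 * ?b i / (2 + ?b i)" for i
    by (rule branch_coverage_le[OF x Suc])
  have "1 - (1 - ?\<alpha> 0) * (1 - ?\<alpha> 1) \<le> 2 * (?b 0 + ?b 1) / (2 + (?b 0 + ?b 1))"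
    by (rule union_bound) (rule \<alpha> b le)+
  moreover have "0 \<le> (1 - ?\<alpha> 0) * (1 - ?\<alpha> 1)" "(1 - ?\<alpha> 0) * (1 - ?\<alpha> 1) \<le> 1"
    using \<alpha> by (auto intro: mult_le_one)
  \<comment> \<open>The first two siblings, already merged, are joined with the third.\<close>
  ultimately have "1 - (1 - (1 - (1 - ?\<alpha> 0) * (1 - ?\<alpha> 1))) * (1 - ?\<alpha> 2)
      \<le> 2 * (?b 0 + ?b 1 + ?b 2) / (2 + (?b 0 + ?b 1 + ?b 2))"
    using \<alpha> b[of 0] b[of 1] by (intro union_bound b le) auto
  moreover have "conductance (Suc n) x y = ?b 0 + ?b 1 + ?b 2"
    by simp
  ultimately show ?case by (simp only: coverage_Suc) simp
qed

text \<open>Jensen's inequality gives \<open>1 / I' \<ge> 1 / I + 1 / 12\<close> for the integrals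
  \<open>I\<close>, \<open>I'\<close> at successive depths (when \<open>I\<close> is positive),
  starting from \<open>I = 2\<close>.\<close>

lemma conductance_integral:
  assumes x: "0 \<le> x" "x \<le> 2"
  shows "integrable lborel (conductance n x) \<and> (\<integral>y. conductance n x y \<partial>lborel) \<le> 12 / (real n + 6)"
proof (induction n)
  case 0
  show ?case by simp
next
  case (Suc n)
  let ?h = "\<lambda>y. attenuate (conductance n x y)"
  define m where "m = (\<integral>y. conductance n x y \<partial>lborel) / 3"
  have m: "0 \<le> m" by (simp add: m_def conductance_nonneg)
  have D: "integrable lborel (conductance n x)" using Suc by blast
  then have [measurable]: "conductance n x \<in> borel_measurable borel"
    by (auto dest: borel_measurable_integrable)
  have "?h \<in> borel_measurable borel" unfolding attenuate_def by measurable
  then have h: "integrable lborel ?h"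
    by (intro Bochner_Integration.integrable_bound[OF D])
      (auto simp: conductance_nonneg attenuate_nonneg attenuate_le intro!: AE_I2)
  \<comment> \<open>Jensen's inequality for the concave function \<open>attenuate\<close>, via its tangent at the mean
    \<open>m\<close> over the interval \<open>[0, 3)\<close> containing the support of \<open>conductance n x\<close>.\<close>
  have "?h y \<le> 2 * m\<^sup>2 / (4 + m)\<^sup>2 * indicator {0..<3} y + 8 / (4 + m)\<^sup>2 * conductance n x y" for y
  proof (cases "y \<in> {0..<3}")
    case True
    define d where "d = conductance n x y"
    have d: "0 \<le> d" by (simp add: d_def conductance_nonneg)
    \<comment> \<open>This square is the gap between the tangent and \<open>attenuate\<close> with
      denominators cleared.\<close>
    have "0 \<le> 8 * (d - m)\<^sup>2" by simp
    then have "2 * d * (4 + m)\<^sup>2 \<le> (2 * m\<^sup>2 + 8 * d) * (4 + d)"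
      by (simp add: power2_eq_square algebra_simps)
    then have "2 * d / (4 + d) \<le> (2 * m\<^sup>2 + 8 * d) / (4 + m)\<^sup>2"
      using d m by (simp add: divide_le_eq le_divide_eq)
    then show ?thesis using True by (simp add: attenuate_def d_def add_divide_distrib)
  next
    case False
    then have "conductance n x y = 0" using x by (intro conductance_outside) auto
    then show ?thesis using False by (simp add: attenuate_def)
  qed
  then have "(\<integral>y. ?h y \<partial>lborel)
      \<le> (\<integral>y. 2 * m\<^sup>2 / (4 + m)\<^sup>2 * indicator {0..<3} y + 8 / (4 + m)\<^sup>2 * conductance n x y \<partial>lborel)"
    using h D by (intro integral_mono) auto
  also have "\<dots> = 2 * m\<^sup>2 / (4 + m)\<^sup>2 * 3 + 8 / (4 + m)\<^sup>2 * (3 * m)"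
    using D by (simp add: m_def)
  also have "\<dots> = 6 * m / (4 + m)"
    using m by (simp add: divide_simps) (simp add: power2_eq_square algebra_simps)
  finally have "(\<integral>y. ?h y \<partial>lborel) \<le> 6 * m / (4 + m)" .
  moreover have "6 * m / (4 + m) \<le> 6 / (real n + 7)"
  proof -
    have "m \<le> 4 / (real n + 6)" using Suc by (simp add: m_def)
    then show ?thesis using m by (simp add: field_simps)
  qed
  moreover have "conductance (Suc n) x = (\<lambda>y. 2 * (branch ?h x 0 y + branch ?h x 1 y + branch ?h x 2 y))"
    by (rule ext) simp
  then have "integrable lborel (conductance (Suc n) x)"
    "(\<integral>y. conductance (Suc n) x y \<partial>lborel) = 2 * (\<integral>y. ?h y \<partial>lborel)"
    using branch_integral(1)[OF h] by (simp_all add: branch_integral(2)[OF h])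
  ultimately show ?case by (simp add: add.commute del: conductance.simps)
qed

lemma coverage_upper:
  assumes x: "1 \<le> x" "x \<le> 2"
  shows "(\<integral>y. coverage n x y \<partial>lborel) \<le> 12 / (real n + 6)"
proof -
  have "coverage n x y \<le> conductance n x y" for y
  proof -
    have "2 * conductance n x y / (2 + conductance n x y) \<le> conductance n x y"
      using conductance_nonneg[of n x y] by (simp add: field_simps)
    then show ?thesis using coverage_le_conductance[OF x(1), of n y] by linarith
  qed
  then have "(\<integral>y. coverage n x y \<partial>lborel) \<le> (\<integral>y. conductance n x y \<partial>lborel)"
    using x conductance_integral[of x n] coverage_integrable[of x n] by (intro integral_mono) auto
  also have "\<dots> \<le> 12 / (real n + 6)" using x conductance_integral[of x n] by simp
  finally show ?thesis .
qed

subsection \<open>Measures of the tubes\<close>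

definition tubes :: "sticky \<Rightarrow> real set \<Rightarrow> plane set" where
  "tubes t A = {z. fst z \<in> A \<and> 0 < overlap t (fst z) (snd z)}"

lemma tubes_borel [measurable]: "A \<in> sets borel \<Longrightarrow> tubes t A \<in> sets borel"
proof -
  assume [measurable]: "A \<in> sets borel"
  have "{z \<in> space (borel :: plane measure). fst z \<in> A \<and> 0 < overlap t (fst z) (snd z)} \<in> sets borel"
    unfolding borel_prod[symmetric] by measurable
  then show ?thesis by (simp add: tubes_def)
qed

lemma tubes_finite:
  assumes "0 \<le> a"
  shows "emeasure lborel (tubes t {a..b}) < \<infinity>"
proof (rule emeasure_bounded_finite[OF bounded_subset[OF bounded_cbox]])
  show "tubes t {a..b} \<subseteq> cbox (a, 0) (b, 1 + b)"
  proof
    fix z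
    assume "z \<in> tubes t {a..b}"
    moreover from this have "0 \<le> snd z \<and> snd z < 1 + fst z"
      using assms overlap_support[of "fst z" t "snd z"] by (auto simp: tubes_def)
    ultimately show "z \<in> cbox (a, 0) (b, 1 + b)"
      by (cases z) (auto simp: tubes_def cbox_Pair_eq cbox_interval)
  qed
qed

lemma hit_integral:
  assumes "0 \<le> x"
  shows "integrable lborel (hit t x)"
    and "emeasure lborel {y. 0 < overlap t x y} = ennreal (\<integral>y. hit t x y \<partial>lborel)"
proof -
  have m: "{y. 0 < overlap t x y} \<in> sets lborel"
  proof -
    have "{y \<in> space borel. 0 < overlap t x y} \<in> sets borel" by measurable
    then show ?thesis by simp
  qed
  have "0 \<le> y \<and> y \<le> 1 + x" if "0 < overlap t x y" for y
    using overlap_support[OF assms, of t y] that by simp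
  then have "{y. 0 < overlap t x y} \<subseteq> cbox 0 (1 + x)"
    by (auto simp: cbox_interval)
  then have fin: "emeasure lborel {y. 0 < overlap t x y} < \<infinity>"
    by (intro emeasure_bounded_finite[OF bounded_subset[OF bounded_cbox]])
  have hit: "hit t x = indicator {y. 0 < overlap t x y}"
    by (auto simp: hit_def indicator_def)
  show "integrable lborel (hit t x)"
    unfolding hit using m fin by (intro integrable_real_indicator)
  show "emeasure lborel {y. 0 < overlap t x y} = ennreal (\<integral>y. hit t x y \<partial>lborel)"
    unfolding hit using m fin by (simp add: emeasure_eq_ennreal_measure)
qed

lemma coverage_integral:
  assumes "0 \<le> x"
  shows "(\<Sum>t\<in>trees n. \<integral>y. hit t x y \<partial>lborel) = card (trees n) * (\<integral>y. coverage n x y \<partial>lborel)"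
proof -
  have "(\<Sum>t\<in>trees n. \<integral>y. hit t x y \<partial>lborel) = (\<integral>y. (\<Sum>t\<in>trees n. hit t x y) \<partial>lborel)"
    using hit_integral[OF assms] by simp
  also have "\<dots> = (\<integral>y. card (trees n) * coverage n x y \<partial>lborel)"
    using finite_trees trees_nonempty by (simp add: coverage_def mean_def)
  finally show ?thesis by simp
qed

text \<open>Tonelli over vertical slices; it turns bounds on \<open>coverage\<close> at fixed
  abscissa into bounds on the average area.\<close>

lemma sum_tubes:
  assumes "0 \<le> a"
  shows "ennreal (\<Sum>t\<in>trees n. measure lborel (tubes t {a..b}))
    = (\<integral>\<^sup>+x. ennreal (card (trees n) * (\<integral>y. coverage n x y \<partial>lborel)) * indicator {a..b} x \<partial>lborel)"
proof -
  have slice: "emeasure lborel (tubes t {a..b})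
      = (\<integral>\<^sup>+x. ennreal (\<integral>y. hit t x y \<partial>lborel) * indicator {a..b} x \<partial>lborel)" for t
  proof -
    have "tubes t {a..b} \<in> sets (lborel \<Otimes>\<^sub>M lborel)"
      unfolding lborel_prod using tubes_borel by simp
    then have "emeasure lborel (tubes t {a..b})
        = (\<integral>\<^sup>+x. emeasure lborel (Pair x -` tubes t {a..b}) \<partial>lborel)"
      by (subst lborel_prod[symmetric]) (rule lborel.emeasure_pair_measure_alt)
    also have "\<dots> = (\<integral>\<^sup>+x. ennreal (\<integral>y. hit t x y \<partial>lborel) * indicator {a..b} x \<partial>lborel)"
    proof (rule nn_integral_cong)
      fix x
      have "Pair x -` tubes t {a..b} = (if x \<in> {a..b} then {y. 0 < overlap t x y} else {})"
        by (auto simp: tubes_def)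
      then show "emeasure lborel (Pair x -` tubes t {a..b})
          = ennreal (\<integral>y. hit t x y \<partial>lborel) * indicator {a..b} x"
        using assms hit_integral(2)[of x t] by auto
    qed
    finally show ?thesis .
  qed
  have "ennreal (\<Sum>t\<in>trees n. measure lborel (tubes t {a..b}))
      = (\<Sum>t\<in>trees n. emeasure lborel (tubes t {a..b}))"
    using tubes_finite[OF assms]
    by (simp add: emeasure_eq_ennreal_measure less_top[symmetric] flip: sum_ennreal)
  also have "\<dots> = (\<integral>\<^sup>+x. (\<Sum>t\<in>trees n. ennreal (\<integral>y. hit t x y \<partial>lborel) * indicator {a..b} x) \<partial>lborel)"
    unfolding slice by (rule nn_integral_sum[symmetric]) measurable
  also have "\<dots> = (\<integral>\<^sup>+x. ennreal (card (trees n) * (\<integral>y. coverage n x y \<partial>lborel)) * indicator {a..b} x \<partial>lborel)"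
  proof (rule nn_integral_cong)
    fix x
    have nn: "0 \<le> (\<integral>y. hit t x y \<partial>lborel)" for t by (simp add: hit_bounds)
    show "(\<Sum>t\<in>trees n. ennreal (\<integral>y. hit t x y \<partial>lborel) * indicator {a..b} x)
        = ennreal (card (trees n) * (\<integral>y. coverage n x y \<partial>lborel)) * indicator {a..b} x"
    proof (cases "x \<in> {a..b}")
      case True
      then have "0 \<le> x" using assms by simp
      from coverage_integral[OF this, of n] True show ?thesis
        by (simp add: nn flip: sum_distrib_right)
    qed simp
  qed
  finally show ?thesis .
qed

text \<open>Integrating \<open>1 / (1 + 6 * n * x)\<close> over the unit interval produces the
  decisive logarithm.\<close>

lemma measure_tubes_lower:
  assumes "0 < n"
  shows "card (trees n) * (ln (1 + 6 * real n) / (6 * real n)) \<le> (\<Sum>t\<in>trees n. measure lborel (tubes t {0..1}))"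
proof -
  let ?N = "real (card (trees n))"
  have "(\<integral>\<^sup>+x. ennreal (?N / (1 + 6 * real n * x)) * indicator {0..1} x \<partial>lborel)
      = ennreal (?N * (ln (1 + 6 * real n * 1) / (6 * real n)) - ?N * (ln (1 + 6 * real n * 0) / (6 * real n)))"
  proof (intro nn_integral_FTC_Icc)
    fix x :: real
    assume "x \<in> {0..1}"
    then have "0 < 1 + 6 * real n * x" by (simp add: add_pos_nonneg)
    then show "((\<lambda>x. ?N * (ln (1 + 6 * real n * x) / (6 * real n)))
        has_real_derivative ?N / (1 + 6 * real n * x)) (at x)"
      using assms by (auto intro!: derivative_eq_intros)
  qed auto
  moreover have "(\<integral>\<^sup>+x. ennreal (?N / (1 + 6 * real n * x)) * indicator {0..1} x \<partial>lborel)
      \<le> ennreal (\<Sum>t\<in>trees n. measure lborel (tubes t {0..1}))"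
    unfolding sum_tubes[OF order_refl]
  proof (rule nn_integral_mono)
    fix x :: real
    show "ennreal (?N / (1 + 6 * real n * x)) * indicator {0..1} x
        \<le> ennreal (?N * (\<integral>y. coverage n x y \<partial>lborel)) * indicator {0..1} x"
    proof (cases "x \<in> {0..1}")
      case True
      then have "?N * (1 / (1 + 6 * real n * x)) \<le> ?N * (\<integral>y. coverage n x y \<partial>lborel)"
        by (intro mult_left_mono coverage_lower) auto
      then show ?thesis by (auto intro!: mult_right_mono ennreal_leI)
    qed simp
  qed
  ultimately show ?thesis
    by (simp add: sum_nonneg)
qed

lemma measure_tubes_upper:
  "(\<Sum>t\<in>trees n. measure lborel (tubes t {1..2})) \<le> card (trees n) * (12 / (real n + 6))"
proof -
  let ?N = "real (card (trees n))"
  have "ennreal (\<Sum>t\<in>trees n. measure lborel (tubes t {1..2}))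
      \<le> (\<integral>\<^sup>+x. ennreal (?N * (12 / (real n + 6))) * indicator {1..2::real} x \<partial>lborel)"
    unfolding sum_tubes[OF zero_le_one]
  proof (rule nn_integral_mono)
    fix x :: real
    show "ennreal (?N * (\<integral>y. coverage n x y \<partial>lborel)) * indicator {1..2} x
        \<le> ennreal (?N * (12 / (real n + 6))) * indicator {1..2} x"
    proof (cases "x \<in> {1..2}")
      case True
      then show ?thesis
        by (intro mult_right_mono ennreal_leI mult_left_mono coverage_upper) auto
    qed simp
  qed
  also have "\<dots> = ennreal (?N * (12 / (real n + 6)))"
    by (simp add: nn_integral_cmult_indicator)
  finally show ?thesis by (simp add: ennreal_le_iff)
qed

subsection \<open>The maximal function\<close>

text \<open>Borel sets have Borel sections on every line, which Lebesgue measurability alone would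
  not give.\<close>

lemma indicator_line_integrable:
  assumes [measurable]: "(E :: plane set) \<in> sets borel"
  shows "set_integrable lebesgue {r..s} (\<lambda>t. indicator E (a + t *\<^sub>R u) :: real)"
proof -
  have "(\<lambda>t::real. a + t *\<^sub>R u) \<in> borel_measurable borel" by measurable
  then have "(\<lambda>t. indicator E (a + t *\<^sub>R u) :: real) \<in> borel_measurable lborel"
    by (auto intro: measurable_compose[OF _ borel_measurable_indicator])
  then have "(\<lambda>t. indicator {r..s} t *\<^sub>R (indicator E (a + t *\<^sub>R u) :: real)) \<in> borel_measurable lebesgue"
    by (intro measurable_completion) auto
  then show ?thesis
    unfolding set_integrable_def
    by (rule integrableI_bounded_set[where A = "{r..s}" and B = 1, rotated])
      (auto simp: indicator_def emeasure_lborel_Icc_eq intro!: AE_I2)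
qed

lemma maximal_tubes:
  assumes "z \<in> tubes t {0..1}"
  shows "ennreal (1 / 2) \<le> cantor_maximal (indicator (tubes t {1..2})) z"
proof -
  let ?E = "tubes t {1..2}"
  obtain x y where z: "z = (x, y)" and x: "0 \<le> x" "x \<le> 1" and pos: "0 < overlap t x y"
    using assms by (cases z) (auto simp: tubes_def)
  obtain c where c: "c \<in> cantor_set" and line: "\<And>x'. 0 < overlap t x' (y + c * (x' - x))"
    using overlap_pos_line[OF pos] by blast
  \<comment> \<open>The segment runs along the tube to abscissa 2. Its midpoint has abscissa
    \<open>1 + x / 2\<close>, so its second half lies over [1, 2].\<close>
  define b :: plane where "b = (2, y + c * (2 - x))"
  define d where "d = dist z b"
  have d: "0 < d" using x by (auto simp: d_def b_def z)
  have seg: "(z, b) \<in> cantor_segments"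
    using x c by (simp add: cantor_segments_def slope_def b_def z)
  have E: "z + s *\<^sub>R sgn (b - z) \<in> ?E" if s: "s \<in> {d / 2..d}" for s
  proof -
    define \<sigma> where "\<sigma> = s / d"
    have \<sigma>: "1 / 2 \<le> \<sigma>" "\<sigma> \<le> 1" using s d by (auto simp: \<sigma>_def field_simps)
    have "z + s *\<^sub>R sgn (b - z) = z + \<sigma> *\<^sub>R (b - z)"
      by (simp add: sgn_div_norm \<sigma>_def d_def dist_norm norm_minus_commute divide_inverse)
    also have "\<dots> = (x + \<sigma> * (2 - x), y + c * ((x + \<sigma> * (2 - x)) - x))"
      by (simp add: b_def z)
    finally have eq: "z + s *\<^sub>R sgn (b - z) = (x + \<sigma> * (2 - x), y + c * ((x + \<sigma> * (2 - x)) - x))" .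
    define w where "w = \<sigma> * (2 - x)"
    have "1 / 2 * (2 - x) \<le> w" "w \<le> 1 * (2 - x)"
      unfolding w_def using \<sigma> x by (intro mult_right_mono; simp)+
    then have "x + w \<in> {1..2}"
      using x by auto
    then show ?thesis
      unfolding eq tubes_def using line[of "x + w"] by (simp add: w_def)
  qed
  have "(\<integral>s. indicator {d / 2..d} s \<partial>lebesgue)
      \<le> (LINT s:{0..d}|lebesgue. \<bar>indicator ?E (z + s *\<^sub>R sgn (b - z)) :: real\<bar>)"
    unfolding set_lebesgue_integral_def
  proof (rule integral_mono)
    show "integrable lebesgue (\<lambda>s. indicator {0..d} s *\<^sub>R \<bar>indicator ?E (z + s *\<^sub>R sgn (b - z)) :: real\<bar>)"
      using indicator_line_integrable[of ?E 0 d z "sgn (b - z)"] by (simp add: set_integrable_def)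
  next
    fix s
    show "indicator {d / 2..d} s \<le> indicator {0..d} s *\<^sub>R \<bar>indicator ?E (z + s *\<^sub>R sgn (b - z)) :: real\<bar>"
      using E[of s] d by (auto simp: indicator_def)
  qed (auto intro!: integrable_real_indicator simp: emeasure_lborel_Icc_eq)
  then have "1 / 2 \<le> segment_average z b (\<lambda>y. \<bar>indicator ?E y\<bar>)"
    using d by (simp add: segment_average_def field_simps flip: d_def)
  then have "ennreal (1 / 2) \<le> ennreal (segment_average z b (\<lambda>y. \<bar>indicator ?E y\<bar>))"
    by (rule ennreal_leI)
  also have "\<dots> \<le> cantor_maximal (indicator ?E) z"
    unfolding cantor_maximal_def by (rule SUP_upper2[of "(z, b)"]) (use seg in auto)
  finally show ?thesis .
qed

section \<open>Norm inequalities turned into area inequalities\<close>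

lemma ennreal_powr_mono:
  assumes "0 < p" "x \<le> y"
  shows "ennreal_powr x p \<le> ennreal_powr y p"
proof (cases "y = \<infinity>")
  case False
  then have "x \<noteq> \<infinity>" using assms(2) by (auto simp: top_unique)
  then show ?thesis
    using False assms
    by (auto simp: ennreal_powr_def less_top intro!: ennreal_leI powr_mono2 enn2real_mono)
qed (simp add: ennreal_powr_def)

lemma ennreal_powr_ennreal: "0 \<le> r \<Longrightarrow> ennreal_powr (ennreal r) p = ennreal (r powr p)"
  by (simp add: ennreal_powr_def)

lemma Lp_norm_indicator:
  assumes "0 < p" and [measurable]: "E \<in> sets borel" and "emeasure lborel E < \<infinity>"
  shows "Lp_norm p (\<lambda>x. ennreal \<bar>indicator E x\<bar>) = ennreal (measure lborel E powr (1 / p))"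
proof -
  have "ennreal_powr (ennreal \<bar>indicator E x\<bar>) p = indicator E x" for x
    using assms(1) by (simp add: ennreal_powr_ennreal indicator_def)
  then have "(\<integral>\<^sup>+x. ennreal_powr (ennreal \<bar>indicator E x\<bar>) p \<partial>lebesgue) = emeasure lborel E"
    by (simp add: nn_integral_completion)
  also have "\<dots> = ennreal (measure lborel E)"
    using assms(3) by (simp add: emeasure_eq_ennreal_measure)
  finally show ?thesis by (simp add: Lp_norm_def ennreal_powr_ennreal)
qed

text \<open>The assumed bound is tested on the indicator of the tubes over [1, 2]. The resulting
  factor is the same for every \<open>t\<close>, so the inequality can be summed over trees.\<close>

lemma maximal_bound_tubes:
  assumes p: "1 \<le> p" and k: "0 \<le> k"
    and bound: "\<And>f::plane \<Rightarrow> real. in_Lp p f \<Longrightarrow> locally_integrable_on_lines f \<Longrightarrow>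
      Lp_norm p (cantor_maximal f) \<le> ennreal k * Lp_norm p (\<lambda>x. ennreal \<bar>f x\<bar>)"
  shows "measure lborel (tubes t {0..1}) \<le> (2 * k) powr p * measure lborel (tubes t {1..2})"
proof -
  let ?E = "tubes t {1..2}" and ?F = "tubes t {0..1}"
  let ?e = "measure lborel ?E" and ?f = "measure lborel ?F"
  have fin: "emeasure lborel ?E < \<infinity>" "emeasure lborel ?F < \<infinity>"
    by (rule tubes_finite; simp)+
  have [measurable]: "?F \<in> sets borel" "?E \<in> sets borel" by auto
  have norm_E: "Lp_norm p (\<lambda>x. ennreal \<bar>indicator ?E x\<bar>) = ennreal (?e powr (1 / p))"
    using p fin by (intro Lp_norm_indicator) auto
  have "in_Lp p (indicator ?E)"
    unfolding in_Lp_def norm_E by (auto intro!: measurable_completion)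
  moreover have "locally_integrable_on_lines (indicator ?E)"
    unfolding locally_integrable_on_lines_def by (intro allI impI indicator_line_integrable tubes_borel) simp
  ultimately have le: "Lp_norm p (cantor_maximal (indicator ?E)) \<le> ennreal k * ennreal (?e powr (1 / p))"
    using bound norm_E by metis
  have "ennreal ((1 / 2) powr p * ?f) = (\<integral>\<^sup>+z. ennreal ((1 / 2) powr p) * indicator ?F z \<partial>lebesgue)"
    using fin by (simp add: nn_integral_completion nn_integral_cmult_indicator emeasure_eq_ennreal_measure
        ennreal_mult)
  also have "\<dots> \<le> (\<integral>\<^sup>+z. ennreal_powr (cantor_maximal (indicator ?E) z) p \<partial>lebesgue)"
  proof (rule nn_integral_mono)
    fix z
    show "ennreal ((1 / 2) powr p) * indicator ?F z \<le> ennreal_powr (cantor_maximal (indicator ?E) z) p"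
    proof (cases "z \<in> ?F")
      case True
      have "ennreal ((1 / 2) powr p) = ennreal_powr (ennreal (1 / 2)) p"
        by (rule ennreal_powr_ennreal[symmetric]) simp
      also have "\<dots> \<le> ennreal_powr (cantor_maximal (indicator ?E) z) p"
        using p by (intro ennreal_powr_mono maximal_tubes[OF True]) simp
      finally show ?thesis using True by simp
    qed simp
  qed
  finally have "ennreal_powr (ennreal ((1 / 2) powr p * ?f)) (1 / p)
      \<le> Lp_norm p (cantor_maximal (indicator ?E))"
    unfolding Lp_norm_def using p by (intro ennreal_powr_mono) auto
  also note le
  also have "ennreal k * ennreal (?e powr (1 / p)) = ennreal (k * ?e powr (1 / p))"
    using k by (simp add: ennreal_mult)
  finally have "((1 / 2) powr p * ?f) powr (1 / p) \<le> k * ?e powr (1 / p)"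
    using k by (simp add: ennreal_powr_ennreal ennreal_le_iff)
  then have "(((1 / 2) powr p * ?f) powr (1 / p)) powr p \<le> (k * ?e powr (1 / p)) powr p"
    using p by (intro powr_mono2) auto
  also have "(((1 / 2) powr p * ?f) powr (1 / p)) powr p = (1 / 2) powr p * ?f"
    unfolding powr_powr using p by simp
  also have "(k * ?e powr (1 / p)) powr p = k powr p * ?e"
    using p k by (simp add: powr_powr powr_mult)
  finally have "(1 / 2) powr p * ?f \<le> k powr p * ?e" .
  then have "2 powr p * ((1 / 2) powr p * ?f) \<le> 2 powr p * (k powr p * ?e)"
    by (intro mult_left_mono) auto
  moreover have "2 powr p * (1 / 2) powr p = (1 :: real)"
    by (simp flip: powr_mult)
  ultimately show ?thesis
    using k by (simp add: powr_mult mult.assoc[symmetric])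
qed

theorem corollary0p2:
  fixes p :: real
  assumes "1 \<le> p"
  shows "\<not> (\<exists>C::ennreal. C < \<infinity> \<and>
           (\<forall>f::plane \<Rightarrow> real. in_Lp p f \<and> locally_integrable_on_lines f \<longrightarrow>
              Lp_norm p (cantor_maximal f) \<le> C * Lp_norm p (\<lambda>x. ennreal \<bar>f x\<bar>)))"
proof
  assume "\<exists>C::ennreal. C < \<infinity> \<and>
           (\<forall>f::plane \<Rightarrow> real. in_Lp p f \<and> locally_integrable_on_lines f \<longrightarrow>
              Lp_norm p (cantor_maximal f) \<le> C * Lp_norm p (\<lambda>x. ennreal \<bar>f x\<bar>))"
  then obtain C :: ennreal where "C < \<infinity>" and C: "\<And>f::plane \<Rightarrow> real. in_Lp p f \<Longrightarrow>
      locally_integrable_on_lines f \<Longrightarrow>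
      Lp_norm p (cantor_maximal f) \<le> C * Lp_norm p (\<lambda>x. ennreal \<bar>f x\<bar>)"
    by blast
  then obtain k where k: "0 \<le> k" "C = ennreal k"
    by (cases C) auto
  define K where "K = (2 * k) powr p"
  \<comment> \<open>72 is 6 times 12, from the denominators \<open>6 * real n\<close> of the lower
    bound and the numerator 12 of the upper bound.\<close>
  obtain n :: nat where n: "exp (72 * K) < real n"
    using reals_Archimedean2 by blast
  have "0 < n" using n by (cases n) (auto simp: not_less[symmetric])
  let ?N = "real (card (trees n))"
  have N: "0 < ?N"
    using finite_trees trees_nonempty by (simp add: card_gt_0_iff)
  have "?N * (ln (1 + 6 * real n) / (6 * real n)) \<le> (\<Sum>t\<in>trees n. measure lborel (tubes t {0..1}))"
    using \<open>0 < n\<close> by (rule measure_tubes_lower)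
  \<comment> \<open>Comparing sums over all trees replaces the choice of one good sticky
    map.\<close>
  also have "\<dots> \<le> (\<Sum>t\<in>trees n. K * measure lborel (tubes t {1..2}))"
    unfolding K_def using assms k C by (intro sum_mono maximal_bound_tubes) auto
  also have "\<dots> \<le> K * (?N * (12 / (real n + 6)))"
    unfolding sum_distrib_left[symmetric]
    by (intro mult_left_mono measure_tubes_upper) (simp add: K_def)
  finally have "?N * (ln (1 + 6 * real n) / (6 * real n)) \<le> ?N * (K * (12 / (real n + 6)))"
    by (simp add: mult_ac)
  then have "ln (1 + 6 * real n) / (6 * real n) \<le> K * (12 / (real n + 6))"
    by (rule mult_left_le_imp_le[OF _ N])
  also have "\<dots> \<le> K * (12 / real n)"
    using \<open>0 < n\<close> by (intro mult_left_mono divide_left_mono) (auto simp: K_def)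
  finally have "ln (1 + 6 * real n) \<le> 72 * K"
    using \<open>0 < n\<close> by (simp add: field_simps)
  moreover have "72 * K < ln (1 + 6 * real n)"
  proof -
    have "exp (72 * K) < 1 + 6 * real n" using n by simp
    then have "ln (exp (72 * K)) < ln (1 + 6 * real n)"
      by (subst ln_less_cancel_iff) auto
    then show ?thesis by simp
  qed
  ultimately show False by simp
qed

end
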